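(* Let $X$ be a Kähler manifold and let $\alpha=\sum_{k\ge1}\hbar^k\omega_k$ be a closed formal $2$-form on $X$. The solution $I\in\mathcal{A}^1_X(\mathcal{W}_{X,\mathbb{C}})$ of the Fedosov equation $$\nabla I-\delta I+\frac1\hbar I\star I+R_\nabla=\alpha$$ satisfying the two conditions $$(\delta^{1,0})^{-1}(I)=0,\qquad \pi_{0,*}(I)=0$$ is unique (i.e. there is at most one such solution).
   Context: **Kähler conventions.** Summation convention. $\omega=\omega_{\alpha\bar\beta}dz^\alpha\wedge d\bar z^\beta=\sqrt{-1}g_{\alpha\bar\beta}dz^\alpha\wedge d\bar z^\beta$ is the Kähler form, $\omega^{\bar\gamma\alpha}\omega_{\alpha\bar\beta}=\delta^{\bar\gamma}_{\bar\beta}$, $\omega^{\alpha\bar\beta}=-\omega^{\bar\beta\alpha}$. **Weyl bundle.** $\overline{\mathcal{W}}_X=\widehat{\mathrm{Sym}}(\overline{T^*X})[[\hbar]]$ and $\mathcal{W}_{X,\mathbb{C}}=\widehat{\mathrm{Sym}}(T^*X)[[\hbar]]\otimes\overline{\mathcal{W}}_X$; local sections are formal power series in $\hbar$, $y^i$ (frame of the holomorphic cotangent bundle) and $\bar y^j$ (frame of the anti-holomorphic cotangent bundle). $\delta=dz^i\wedge\partial_{y^i}+d\bar z^j\wedge\partial_{\bar y^j}$. $(\delta^{1,0})^{-1}a=\frac{1}{p_1+p_2}y^k\iota_{\partial_{z^k}}a$ if $a$ has form type $(p_1,q_1)$ and degree $p_2$ in the $y$'s (zero if $p_1+p_2=0$).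 $\pi_{0,*}:\mathcal{A}_X^\bullet(\mathcal{W}_{X,\mathbb{C}})\to\mathcal{A}_X^{0,\bullet}(\overline{\mathcal{W}}_X)$ is the natural projection (keeping exactly the terms containing no $dz^i$ and no $y^i$). Wick product: $a\star b=\sum_k\frac{\hbar^k}{k!}\omega^{i_1\bar j_1}\cdots\omega^{i_k\bar j_k}\partial_{y^{i_1}}\cdots\partial_{y^{i_k}}a\;\partial_{\bar y^{j_1}}\cdots\partial_{\bar y^{j_k}}b$, with form parts wedged. $\nabla$ is the Levi-Civita connection; $\nabla^2(y^m)=R_{i\bar jk}^mdz^i\wedge d\bar z^j\otimes y^k$, $R_{i\bar jk\bar l}=R_{i\bar jk}^mg_{m\bar l}$, $R_\nabla=\sqrt{-1}R_{i\bar jk\bar l}dz^i\wedge d\bar z^j\otimes y^k\bar y^l$. *)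

theory Defs
  imports "HOL-Analysis.Analysis" "HOL-Library.Multiset"
begin

section \<open>Complex manifolds\<close>

text \<open>\<open>C\<^sup>\<infinity>\<close> functions on an open set: all iterated (real) directional derivatives are
  differentiable.\<close>

definition smooth_fun_on :: "(complex^'n) set \<Rightarrow> (complex^'n \<Rightarrow> complex) \<Rightarrow> bool" where
  "smooth_fun_on S f \<longleftrightarrow>
     (\<forall>vs. \<forall>z\<in>S. foldr (\<lambda>v h w. frechet_derivative h (at w) v) vs f differentiable (at z))"

definition holomorphic_map_on :: "(complex^'n) set \<Rightarrow> (complex^'n \<Rightarrow> complex^'n) \<Rightarrow> bool" where
  "holomorphic_map_on S F \<longleftrightarrow>
     (\<forall>z\<in>S. \<exists>D. (F has_derivative D) (at z) \<and> (\<forall>c v. D (c *s v) = c *s D v))"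

type_synonym ('a, 'n) chart = "'a set \<times> ('a \<Rightarrow> complex^'n)"

definition chart_image :: "('a, 'n) chart \<Rightarrow> (complex^'n) set" where
  "chart_image c = snd c ` fst c"

definition transition :: "('a, 'n) chart \<Rightarrow> ('a, 'n) chart \<Rightarrow> complex^'n \<Rightarrow> complex^'n" where
  "transition c d = snd d \<circ> inv_into (fst c) (snd c)"

definition complex_manifold :: "'a topology \<Rightarrow> ('a, 'n::finite) chart set \<Rightarrow> bool" where
  "complex_manifold X \<A> \<longleftrightarrow>
     Hausdorff_space X \<and> second_countable X \<and>
     \<Union> (fst ` \<A>) = topspace X \<and>
     (\<forall>c\<in>\<A>. openin X (fst c) \<and> open (chart_image c) \<and>
        homeomorphic_map (subtopology X (fst c)) (top_of_set (chart_image c)) (snd c)) \<and>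
     (\<forall>c\<in>\<A>. \<forall>d\<in>\<A>. holomorphic_map_on (snd c ` (fst c \<inter> fst d)) (transition c d))"


section \<open>Weyl-bundle valued forms in local coordinates\<close>

text \<open>Indices of the complexified frames: \<open>Inl i\<close> stands for the holomorphic direction
  (\<open>z\<^sup>i\<close>, \<open>y\<^sup>i\<close>), \<open>Inr i\<close> for the anti-holomorphic one (conjugates of \<open>z\<^sup>i\<close>, \<open>y\<^sup>i\<close>).\<close>

type_synonym 'n idx = "'n + 'n"

text \<open>A \<open>p\<close>-form \<open>w\<close> is given by its components \<open>w [A\<^sub>1, \<dots>, A\<^sub>p]\<close>, its values on the coordinate
  vector fields; thus \<open>dx\<^sup>A \<and> dx\<^sup>B\<close> has value \<open>1\<close> on \<open>[A, B]\<close> and \<open>-1\<close> on \<open>[B, A]\<close>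
  if \<open>A \<noteq> B\<close>.\<close>

type_synonym 'n dform = "'n idx list \<Rightarrow> complex^'n \<Rightarrow> complex"

text \<open>For a Weyl-bundle valued form \<open>a\<close>, \<open>a h m\<close> is the form multiplying \<open>\<hbar>\<^sup>h\<close> and the monomial
  \<open>\<Prod>A\<in>#m. y\<^sup>A\<close> in the formal power series \<open>a\<close>.\<close>

type_synonym 'n wform = "nat \<Rightarrow> 'n idx multiset \<Rightarrow> 'n dform"

text \<open>Wirtinger derivatives.\<close>

definition pd :: "'n::finite idx \<Rightarrow> (complex^'n \<Rightarrow> complex) \<Rightarrow> complex^'n \<Rightarrow> complex" where
  "pd A f z = (let D = frechet_derivative f (at z) in
     case A of Inl i \<Rightarrow> (D (axis i 1) - \<i> * D (axis i \<i>)) / 2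
             | Inr i \<Rightarrow> (D (axis i 1) + \<i> * D (axis i \<i>)) / 2)"

text \<open>The operator \<open>\<Sum>A. dx\<^sup>A \<and> b A\<close>.\<close>

definition dx_wedge :: "('n idx \<Rightarrow> 'n dform) \<Rightarrow> 'n dform" where
  "dx_wedge b L z = (\<Sum>r<length L. (-1) ^ r * b (L ! r) (take r L @ drop (Suc r) L) z)"

definition ext_deriv :: "'n::finite dform \<Rightarrow> 'n dform" where
  "ext_deriv w = dx_wedge (\<lambda>A L. pd A (w L))"

definition dy :: "'n idx \<Rightarrow> 'n wform \<Rightarrow> 'n wform" where
  "dy A a h m L z = of_nat (Suc (count m A)) * a h (add_mset A m) L z"

definition y_mult :: "'n idx \<Rightarrow> 'n wform \<Rightarrow> 'n wform" where
  "y_mult A a h m L z = (if A \<in># m then a h (m - {#A#}) L z else 0)"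

definition contract :: "'n idx \<Rightarrow> 'n wform \<Rightarrow> 'n wform" where
  "contract A a h m L z = a h m (A # L) z"

definition delta :: "'n wform \<Rightarrow> 'n wform" where
  "delta a h m = dx_wedge (\<lambda>A. dy A a h m)"

text \<open>The factor \<open>1/(p\<^sub>1 + p\<^sub>2)\<close> is applied to each homogeneous component of \<open>a\<close>; for
  \<open>p\<^sub>1 + p\<^sub>2 = 0\<close> it is \<open>0\<close> by the convention \<open>x / 0 = 0\<close>.\<close>

definition delta10_inv :: "'n::finite wform \<Rightarrow> 'n wform" where
  "delta10_inv a h m L z =
     (\<Sum>i\<in>UNIV. y_mult (Inl i) (contract (Inl i)
        (\<lambda>h m L z. a h m L z / of_nat (length (filter isl L) + size (filter_mset isl m)))) h m L z)"

definition pi0 :: "'n wform \<Rightarrow> 'n wform" where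
  "pi0 a h m L z = (if (\<forall>A\<in>#m. \<not> isl A) \<and> (\<forall>A\<in>set L. \<not> isl A) then a h m L z else 0)"

text \<open>Product of power series with form parts wedged: \<open>S\<close> runs over the positions of the arguments
  that are inserted into the first factor, and the sign is that of the corresponding shuffle.\<close>

definition shuffle_sign :: "nat \<Rightarrow> nat set \<Rightarrow> complex" where
  "shuffle_sign p S = (-1) ^ card {(i, j). i < j \<and> j < p \<and> i \<notin> S \<and> j \<in> S}"

definition wmult :: "'n wform \<Rightarrow> 'n wform \<Rightarrow> 'n wform" where
  "wmult a b h m L z =
     (\<Sum>r\<le>h. \<Sum>m'\<in>{m'. m' \<subseteq># m}. \<Sum>S\<in>Pow {..<length L}.
        shuffle_sign (length L) S * a r m' (nths L S) z * b (h - r) (m - m') (nths L (- S)) z)"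


section \<open>Geometry of the Kaehler form in local coordinates\<close>

text \<open>From here on \<open>w\<close> is the coordinate expression of the Kaehler form
  \<open>\<omega> = \<omega>\<^sub>i\<^sub>j dz\<^sup>i \<and> dzbar\<^sup>j = \<i> g\<^sub>i\<^sub>j dz\<^sup>i \<and> dzbar\<^sup>j\<close>.\<close>

definition kahler_metric :: "'n dform \<Rightarrow> 'n \<Rightarrow> 'n \<Rightarrow> complex^'n \<Rightarrow> complex" where
  "kahler_metric w i j z = - \<i> * w [Inl i, Inr j] z"

text \<open>\<open>omega_inv w i j\<close> is \<open>\<omega>\<close> with upper indices \<open>i\<close>, \<open>jbar\<close>, in this order: minus the
  \<open>(j, i)\<close> entry of the inverse of the matrix \<open>(\<omega>\<^sub>i\<^sub>j)\<close>.\<close>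

definition omega_inv :: "'n::finite dform \<Rightarrow> 'n \<Rightarrow> 'n \<Rightarrow> complex^'n \<Rightarrow> complex" where
  "omega_inv w i j z = - (matrix_inv (\<chi> k l. w [Inl k, Inr l] z) $ j $ i)"

definition wick :: "'n::finite dform \<Rightarrow> 'n wform \<Rightarrow> 'n wform \<Rightarrow> 'n wform" where
  "wick w a b h m L z =
     (\<Sum>k\<le>h. 1 / fact k *
        (\<Sum>is\<in>{is. length is = k}. \<Sum>js\<in>{js. length js = k}.
           (\<Prod>r<k. omega_inv w (is ! r) (js ! r) z) *
           wmult (foldr (\<lambda>i. dy (Inl i)) is a) (foldr (\<lambda>j. dy (Inr j)) js b) (h - k) m L z))"

text \<open>Complex bilinear extension of the Riemannian metric (up to a constant factor), and its
  Levi-Civita connection via the Christoffel symbols in the frame \<open>\<partial>/\<partial>z\<^sup>i, \<partial>/\<partial>zbar\<^sup>i\<close>.\<close>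

definition riem_metric :: "'n dform \<Rightarrow> 'n idx \<Rightarrow> 'n idx \<Rightarrow> complex^'n \<Rightarrow> complex" where
  "riem_metric w A B z = (case (A, B) of
       (Inl i, Inr j) \<Rightarrow> kahler_metric w i j z
     | (Inr j, Inl i) \<Rightarrow> kahler_metric w i j z
     | _ \<Rightarrow> 0)"

definition christoffel :: "'n::finite dform \<Rightarrow> 'n idx \<Rightarrow> 'n idx \<Rightarrow> 'n idx \<Rightarrow> complex^'n \<Rightarrow> complex"
  where
  "christoffel w C A B z = 1/2 * (\<Sum>D\<in>UNIV. matrix_inv (\<chi> E F. riem_metric w E F z) $ C $ D *
     (pd A (riem_metric w D B) z + pd B (riem_metric w D A) z - pd D (riem_metric w A B) z))"

text \<open>Components are differentiated and \<open>\<nabla> y\<^sup>B = - \<Gamma>\<^sup>B\<^sub>A\<^sub>C dx\<^sup>A \<otimes> y\<^sup>C\<close>, extended as a derivation;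
  \<open>\<nabla>\<close> on forms is the resulting exterior covariant derivative.\<close>

definition cov_deriv :: "'n::finite dform \<Rightarrow> 'n idx \<Rightarrow> 'n wform \<Rightarrow> 'n wform" where
  "cov_deriv w A a h m L z = pd A (a h m L) z -
     (\<Sum>B\<in>UNIV. \<Sum>C\<in>UNIV. christoffel w B A C z * y_mult C (dy B a) h m L z)"

definition nabla :: "'n::finite dform \<Rightarrow> 'n wform \<Rightarrow> 'n wform" where
  "nabla w a h m = dx_wedge (\<lambda>A. cov_deriv w A a h m)"

definition y_gen :: "'n idx \<Rightarrow> 'n wform" where
  "y_gen A h m L z = (if h = 0 \<and> m = {#A#} \<and> L = [] then 1 else 0)"

text \<open>\<open>curv w i j k m\<close> is \<open>R\<close> with lower indices \<open>i\<close>, \<open>jbar\<close>, \<open>k\<close> and upper index \<open>m\<close>.\<close>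

definition curv :: "'n::finite dform \<Rightarrow> 'n \<Rightarrow> 'n \<Rightarrow> 'n \<Rightarrow> 'n \<Rightarrow> complex^'n \<Rightarrow> complex" where
  "curv w i j k m z = nabla w (nabla w (y_gen (Inl m))) 0 {#Inl k#} [Inl i, Inr j] z"

definition curv_low :: "'n::finite dform \<Rightarrow> 'n \<Rightarrow> 'n \<Rightarrow> 'n \<Rightarrow> 'n \<Rightarrow> complex^'n \<Rightarrow> complex" where
  "curv_low w i j k l z = (\<Sum>m\<in>UNIV. curv w i j k m z * kahler_metric w m l z)"

definition R_nabla :: "'n::finite dform \<Rightarrow> 'n wform" where
  "R_nabla w h m L z =
     (\<Sum>k\<in>UNIV. \<Sum>l\<in>UNIV. if h = 0 \<and> m = {#Inl k, Inr l#} then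
        (case L of [Inl i, Inr j] \<Rightarrow> \<i> * curv_low w i j k l z
                 | [Inr j, Inl i] \<Rightarrow> - \<i> * curv_low w i j k l z
                 | _ \<Rightarrow> 0) else 0)"


section \<open>Global sections\<close>

text \<open>A global Weyl-bundle valued form is a compatible family of coordinate expressions, one for
  each chart. Coordinate expressions are normalised to vanish off the chart image, so that equality
  of families is equality of sections.

  The change of frame is \<open>dw\<^sup>A = \<Sum>B. (\<partial>w\<^sup>A/\<partial>x\<^sup>B) dx\<^sup>B\<close>, and likewise for the \<open>y\<^sup>A\<close>. It is expressed
  by evaluating the homogeneous polynomial parts on (complexified) tangent vectors, where
  \<open>jac F z\<close> is the complexified differential of \<open>F\<close>.\<close>

definition jac :: "(complex^'n \<Rightarrow> complex^'n::finite) \<Rightarrow> complex^'n \<Rightarrow>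
    ('n idx \<Rightarrow> complex) \<Rightarrow> 'n idx \<Rightarrow> complex" where
  "jac F z v A = (\<Sum>B\<in>UNIV. v B *
     pd B (\<lambda>x. case A of Inl i \<Rightarrow> F x $ i | Inr i \<Rightarrow> cnj (F x $ i)) z)"

definition weval :: "'n::finite wform \<Rightarrow> nat \<Rightarrow> nat \<Rightarrow> complex^'n \<Rightarrow>
    ('n idx \<Rightarrow> complex) list \<Rightarrow> ('n idx \<Rightarrow> complex) \<Rightarrow> complex" where
  "weval a h d z V v = (\<Sum>L\<in>{L. length L = length V}. \<Sum>m\<in>{m. size m = d}.
     a h m L z * (\<Prod>r<length V. (V ! r) (L ! r)) * (\<Prod>A\<in>#m. v A))"

definition weyl_form :: "('a, 'n::finite) chart set \<Rightarrow> nat \<Rightarrow> (('a, 'n) chart \<Rightarrow> 'n wform) \<Rightarrow> bool"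
  where
  "weyl_form \<A> p I \<longleftrightarrow>
     (\<forall>c h m L z. c \<notin> \<A> \<or> z \<notin> chart_image c \<longrightarrow> I c h m L z = 0) \<and>
     (\<forall>c\<in>\<A>. \<forall>h m L. length L \<noteq> p \<longrightarrow> (\<forall>z. I c h m L z = 0)) \<and>
     (\<forall>c\<in>\<A>. \<forall>h m K A B L z. I c h m (K @ A # B # L) z = - I c h m (K @ B # A # L) z) \<and>
     (\<forall>c\<in>\<A>. \<forall>h m L. smooth_fun_on (chart_image c) (I c h m L)) \<and>
     (\<forall>c\<in>\<A>. \<forall>d\<in>\<A>. \<forall>x \<in> fst c \<inter> fst d. \<forall>h n V v.
        weval (I c) h n (snd c x) V v =
        weval (I d) h n (snd d x) (map (jac (transition c d) (snd c x)) V)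
          (jac (transition c d) (snd c x) v))"

definition weyl_of_form :: "'n dform \<Rightarrow> 'n wform" where
  "weyl_of_form w h m L z = (if h = 0 \<and> m = {#} then w L z else 0)"

definition diff_form :: "('a, 'n::finite) chart set \<Rightarrow> nat \<Rightarrow> (('a, 'n) chart \<Rightarrow> 'n dform) \<Rightarrow> bool"
  where
  "diff_form \<A> p \<eta> \<longleftrightarrow> weyl_form \<A> p (\<lambda>c. weyl_of_form (\<eta> c))"

definition closed_form :: "('a, 'n::finite) chart set \<Rightarrow> (('a, 'n) chart \<Rightarrow> 'n dform) \<Rightarrow> bool" where
  "closed_form \<A> \<eta> \<longleftrightarrow> (\<forall>c\<in>\<A>. \<forall>L. \<forall>z\<in>chart_image c. ext_deriv (\<eta> c) L z = 0)"

definition kahler_manifold ::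
    "'a topology \<Rightarrow> ('a, 'n::finite) chart set \<Rightarrow> (('a, 'n) chart \<Rightarrow> 'n dform) \<Rightarrow> bool" where
  "kahler_manifold X \<A> \<omega> \<longleftrightarrow>
     complex_manifold X \<A> \<and> diff_form \<A> 2 \<omega> \<and> closed_form \<A> \<omega> \<and>
     (\<forall>c\<in>\<A>. \<forall>z\<in>chart_image c.
        (\<forall>i j. \<omega> c [Inl i, Inl j] z = 0 \<and> \<omega> c [Inr i, Inr j] z = 0) \<and>
        (\<forall>i j. kahler_metric (\<omega> c) j i z = cnj (kahler_metric (\<omega> c) i j z)) \<and>
        (\<forall>v::complex^'n. v \<noteq> 0 \<longrightarrow>
           0 < Re (\<Sum>i\<in>UNIV. \<Sum>j\<in>UNIV. kahler_metric (\<omega> c) i j z * v $ i * cnj (v $ j))))"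

definition weyl_eq :: "('a, 'n::finite) chart set \<Rightarrow>
    (('a, 'n) chart \<Rightarrow> 'n wform) \<Rightarrow> (('a, 'n) chart \<Rightarrow> 'n wform) \<Rightarrow> bool" where
  "weyl_eq \<A> a b \<longleftrightarrow> (\<forall>c\<in>\<A>. \<forall>h m L. \<forall>z\<in>chart_image c. a c h m L z = b c h m L z)"

text \<open>The formal form \<open>\<Sum>k\<ge>1. \<hbar>\<^sup>k \<eta>\<^sub>k\<close>, as a form with values in the Weyl bundle.\<close>

definition formal_form :: "(nat \<Rightarrow> ('a, 'n::finite) chart \<Rightarrow> 'n dform) \<Rightarrow> ('a, 'n) chart \<Rightarrow> 'n wform" where
  "formal_form \<eta> c h m L z = (if h \<ge> 1 \<and> m = {#} then \<eta> h c L z else 0)"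


section \<open>The Fedosov equation\<close>

text \<open>Division by \<open>\<hbar>\<close>, to be applied to series without \<open>\<hbar>\<^sup>0\<close> term. It is applied below to
  \<open>I \<star> I\<close> for a 1-form \<open>I\<close>, which is such a series by \<open>wick_self_hbar_0\<close>.\<close>

definition hbar_div :: "'n wform \<Rightarrow> 'n wform" where
  "hbar_div a h = a (Suc h)"

definition fedosov_equation :: "('a, 'n::finite) chart set \<Rightarrow> (('a, 'n) chart \<Rightarrow> 'n dform) \<Rightarrow>
    (('a, 'n) chart \<Rightarrow> 'n wform) \<Rightarrow> (('a, 'n) chart \<Rightarrow> 'n wform) \<Rightarrow> bool" where
  "fedosov_equation \<A> \<omega> \<alpha> I \<longleftrightarrow>
     weyl_eq \<A> (\<lambda>c h m L z. nabla (\<omega> c) (I c) h m L z - delta (I c) h m L z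
        + hbar_div (wick (\<omega> c) (I c) (I c)) h m L z + R_nabla (\<omega> c) h m L z) \<alpha>"

lemma wick_self_hbar_0:
  assumes a: "\<And>h m L z. length L \<noteq> 1 \<Longrightarrow> a h m L z = 0"
  shows "wick w a a 0 m L z = 0"
proof -
  have 1: "wick w a a 0 m L z = wmult a a 0 m L z"
    by (simp add: wick_def)
  show ?thesis
  proof (cases "length L = 2")
    case False
    have "a h m' (nths L S) z * a h' m'' (nths L (- S)) z = 0" for h h' m' m'' S
    proof -
      have "length (nths L S) + length (nths L (- S)) = length L"
      proof (induction L arbitrary: S)
        case (Cons x xs)
        have "{j. Suc j \<in> - S} = - {j. Suc j \<in> S}" by auto
        with Cons[of "{j. Suc j \<in> S}"] show ?case by (simp add: nths_Cons)
      qed simp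
      with False have "length (nths L S) \<noteq> 1 \<or> length (nths L (- S)) \<noteq> 1" by auto
      then show ?thesis using a by auto
    qed
    then have "wmult a a 0 m L z = 0"
      unfolding wmult_def by (intro sum.neutral ballI) (simp only: mult.assoc mult_zero_right)
    with 1 show ?thesis by simp
  next
    case True
    then obtain A B where L: "L = [A, B]"
      by (metis One_nat_def Suc_1 length_0_conv length_Suc_conv)
    have P: "Pow {..<length L} = {{}, {0}, {1}, {0, 1}}"
      unfolding L by (auto simp: lessThan_Suc)
    have e0: "{(i, j). i < j \<and> j < (2::nat) \<and> i \<notin> {0} \<and> j \<in> {0}} = {}" by auto
    have e1: "{(i, j). i < j \<and> j < (2::nat) \<and> i \<notin> {1} \<and> j \<in> {1}} = {(0, 1)}" by auto
    have s: "shuffle_sign 2 {0} = 1" "shuffle_sign 2 {1} = -1"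
      unfolding shuffle_sign_def e0 e1 by simp_all
    have "wmult a a 0 m L z = (\<Sum>m'\<in>{m'. m' \<subseteq># m}.
        a 0 m' [A] z * a 0 (m - m') [B] z - a 0 m' [B] z * a 0 (m - m') [A] z)"
      unfolding wmult_def P using s by (simp add: L nths_Cons a numeral_2_eq_2)
    also have "\<dots> = (\<Sum>m'\<in>{m'. m' \<subseteq># m}. a 0 m' [A] z * a 0 (m - m') [B] z)
        - (\<Sum>m'\<in>{m'. m' \<subseteq># m}. a 0 m' [B] z * a 0 (m - m') [A] z)"
      by (rule sum_subtractf)
    also have "(\<Sum>m'\<in>{m'. m' \<subseteq># m}. a 0 m' [B] z * a 0 (m - m') [A] z) =
        (\<Sum>m'\<in>{m'. m' \<subseteq># m}. a 0 m' [A] z * a 0 (m - m') [B] z)"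
      by (rule sum.reindex_bij_witness[of _ "\<lambda>k. m - k" "\<lambda>k. m - k"])
         (auto simp: subset_mset.diff_diff_right mult.commute)
    finally show ?thesis using 1 by simp
  qed
qed

text \<open>\<open>christoffel\<close> is symmetric (torsion-free) and metric, i.e. it is the Levi-Civita connection.\<close>

lemma riem_metric_sym: "riem_metric w A B z = riem_metric w B A z"
  by (auto simp: riem_metric_def split: sum.split)

lemma riem_metric_sym_fun: "riem_metric w A B = riem_metric w B A"
  by (rule ext) (rule riem_metric_sym)

lemma christoffel_torsion_free: "christoffel w C A B z = christoffel w C B A z"
  unfolding christoffel_def by (simp add: riem_metric_sym_fun[of w A B] add.commute)

lemma christoffel_metric:
  assumes "invertible (\<chi> E F. riem_metric w E F z)"
  shows "pd A (riem_metric w B C) z =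
    (\<Sum>D\<in>UNIV. christoffel w D A B z * riem_metric w D C z
              + christoffel w D A C z * riem_metric w B D z)"
proof -
  let ?G = "\<chi> E F. riem_metric w E F z"
  define T where "T A B D = pd A (riem_metric w D B) z + pd B (riem_metric w D A) z
    - pd D (riem_metric w A B) z" for A B D
  have inv: "?G ** matrix_inv ?G = mat 1"
    using assms unfolding invertible_def matrix_inv_def by (rule someI2_ex) simp
  have low: "(\<Sum>D\<in>UNIV. christoffel w D A B z * riem_metric w C D z) = T A B C / 2" for A B C
  proof -
    have "(\<Sum>D\<in>UNIV. christoffel w D A B z * riem_metric w C D z) =
        (\<Sum>D\<in>UNIV. \<Sum>E\<in>UNIV. riem_metric w C D z * matrix_inv ?G $ D $ E * T A B E / 2)"
      unfolding christoffel_def T_def[symmetric]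
      by (simp add: sum_distrib_left sum_distrib_right sum_divide_distrib algebra_simps)
    also have "\<dots> = (\<Sum>E\<in>UNIV. (?G ** matrix_inv ?G) $ C $ E * T A B E / 2)"
      by (subst sum.swap) (simp add: matrix_matrix_mult_def sum_distrib_right sum_divide_distrib)
    also have "\<dots> = (\<Sum>E\<in>UNIV. if E = C then T A B E / 2 else 0)"
      unfolding inv by (intro sum.cong) (auto simp: mat_def)
    finally show ?thesis by simp
  qed
  have "(\<Sum>D\<in>UNIV. christoffel w D A B z * riem_metric w D C z
      + christoffel w D A C z * riem_metric w B D z) = T A B C / 2 + T A C B / 2"
    unfolding sum.distrib riem_metric_sym[of w _ C] low by (rule refl)
  also have "\<dots> = pd A (riem_metric w B C) z"
    unfolding T_def
    by (simp add: riem_metric_sym_fun[of w C B] riem_metric_sym_fun[of w B A]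
        riem_metric_sym_fun[of w C A] field_simps)
  finally show ?thesis by simp
qed

end

theory Submission
  imports Defs
begin

text \<open>Give \<open>\<hbar>\<close> weight 2 and each of \<open>y\<^sup>i\<close>, \<open>ybar\<^sup>j\<close> weight 1. Then \<open>\<nabla>\<close> preserves the weight,
  \<open>\<delta>\<close> lowers it by 1, and \<open>1/\<hbar> a \<star> b\<close> of components of weights \<open>s\<close> and \<open>t\<close> has weight
  \<open>s + t - 2\<close>, since a contraction trades a pair \<open>y\<^sup>i\<close>, \<open>ybar\<^sup>j\<close> for one \<open>\<hbar>\<close>. Hence the part of weight
  \<open>w - 1\<close> of the Fedosov equation expresses \<open>\<delta>\<close> of the weight \<open>w\<close> part \<open>I\<^sub>w\<close> of \<open>I\<close> by the
  curvature, the right-hand side and components of lower weight, as soon as \<open>I\<close> has no components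
  of weight 0 and 1. So if two solutions agree in weights below \<open>w\<close>, the weight \<open>w\<close> part \<open>D\<close> of their difference satisfies \<open>\<delta> D = 0\<close>.

  A \<open>\<delta>\<close>-closed 1-form \<open>D\<close> that satisfies the gauge conditions \<open>(\<delta>\<^sup>1\<^sup>,\<^sup>0)\<^sup>-\<^sup>1 D = 0\<close> and
  \<open>\<pi>\<^sub>0 D = 0\<close> vanishes (lemma \<open>closed_gauge_fixed_zero\<close>): the component of type \<open>(2,0)\<close> of
  \<open>\<delta> D = 0\<close> says that \<open>\<delta>\<^sup>1\<^sup>,\<^sup>0 D\<^sup>1\<^sup>,\<^sup>0 = 0\<close>, so that \<open>D\<^sup>1\<^sup>,\<^sup>0 = 0\<close> by the Euler homotopy formula; the
  component of type \<open>(1,1)\<close> then says that \<open>D\<^sup>0\<^sup>,\<^sup>1\<close> does not depend on the \<open>y\<^sup>i\<close>, and what is left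
  is excluded by \<open>\<pi>\<^sub>0 D = 0\<close>.

  It remains to see that weights 0 and 1 do not occur (lemma \<open>solution_low_weight\<close>). In weight 0
  this follows from the two gauge conditions alone. They also show that the weight 1 part has no term in
  \<open>ybar\<^sup>j\<close>; since the Wick product differentiates its second factor in \<open>ybar\<^sup>j\<close>, the quadratic term
  does not contribute to the weight 0 part of the equation. This part is therefore \<open>\<delta> I\<^sub>1 = 0\<close>, and
  \<open>I\<^sub>1 = 0\<close>.

  The argument takes place in each chart separately, and only differentiates functions already known
  to be equal.\<close>

section \<open>Gauge-fixed closed 1-forms\<close>

text \<open>Here \<open>d m A\<close> is the coefficient of \<open>y\<^sup>m dx\<^sup>A\<close> at a point, for a fixed power of \<open>\<hbar>\<close>.\<close>

lemma closed_gauge_fixed_zero: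
  fixes d :: "'n::finite idx multiset \<Rightarrow> 'n idx \<Rightarrow> complex"
  assumes gauge: "\<And>m. (\<Sum>i\<in>UNIV. if Inl i \<in># m then d (m - {#Inl i#}) (Inl i) else 0) = 0"
    and proj: "\<And>m j. (\<forall>A\<in>#m. \<not> isl A) \<Longrightarrow> d m (Inr j) = 0"
    and closed: "\<And>m A B. Suc (size m) = n \<Longrightarrow>
      of_nat (Suc (count m A)) * d (add_mset A m) B = of_nat (Suc (count m B)) * d (add_mset B m) A"
    and m: "size m = n"
  shows "d m A = 0"
proof -
  have hol: "d m (Inl k) = 0" if m: "size m = n" for m k
  proof -
    define M where "M = add_mset (Inl k) m"
    \<comment> \<open>Closedness makes the terms of the gauge condition for \<open>M\<close> proportional to each other.\<close>
    have proportional: "of_nat (count M (Inl k)) * (if Inl i \<in># M then d (M - {#Inl i#}) (Inl i) else 0)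
        = of_nat (count M (Inl i)) * d m (Inl k)" for i
    proof (cases "Inl i \<in># M \<and> i \<noteq> k")
      case False
      then consider "i = k" | "Inl i \<notin># M" by blast
      then show ?thesis
      proof cases
        case 1
        then show ?thesis by (simp add: M_def)
      next
        case 2
        moreover from 2 have "count M (Inl i) = 0" by (simp add: not_in_iff)
        ultimately show ?thesis by simp
      qed
    next
      case True
      then have ne: "i \<noteq> k" and "Inl i \<in># m" by (auto simp: M_def)
      then obtain m0 where m0: "m = add_mset (Inl i) m0" by (metis insert_DiffM)
      then have "Suc (size m0) = n" using m by simp
      from closed[OF this, of "Inl k" "Inl i"] ne show ?thesis by (simp add: M_def m0)
    qed
    have "(\<Sum>i\<in>UNIV. of_nat (count M (Inl i)) * d m (Inl k)) = 0"
      unfolding proportional[symmetric] sum_distrib_left[symmetric] gauge by simp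
    then have "of_nat (\<Sum>i\<in>UNIV. count M (Inl i)) * d m (Inl k) = 0"
      by (simp add: sum_distrib_right)
    moreover have "(\<Sum>i\<in>UNIV. count M (Inl i)) \<noteq> 0" by (auto simp: M_def)
    ultimately show ?thesis by (metis mult_eq_0_iff of_nat_eq_0_iff)
  qed
  show ?thesis
  proof (cases A)
    case (Inl k)
    with hol[OF m] show ?thesis by simp
  next
    case (Inr j)
    show ?thesis
    proof (cases "\<forall>B\<in>#m. \<not> isl B")
      case True
      with proj Inr show ?thesis by simp
    next
      case False
      then obtain k where "Inl k \<in># m" by (metis isl_def)
      then obtain m0 where m0: "m = add_mset (Inl k) m0" by (metis insert_DiffM)
      then have s: "Suc (size m0) = n" using m by simp
      have "d (add_mset (Inr j) m0) (Inl k) = 0" using s by (intro hol) simp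
      with closed[OF s, of "Inl k" "Inr j"] have "of_nat (Suc (count m0 (Inl k))) * d m (Inr j) = 0"
        by (simp add: m0)
      with Inr show ?thesis by (metis mult_eq_0_iff of_nat_eq_0_iff nat.distinct(1))
    qed
  qed
qed

lemma delta_pair:
  "delta a h m [A, B] z = of_nat (Suc (count m A)) * a h (add_mset A m) [B] z
     - of_nat (Suc (count m B)) * a h (add_mset B m) [A] z"
  by (simp add: delta_def dx_wedge_def dy_def numeral_2_eq_2)

text \<open>On the coefficients of \<open>dz\<^sup>i\<close> in a 1-form, \<open>(\<delta>\<^sup>1\<^sup>,\<^sup>0)\<^sup>-\<^sup>1\<close> is multiplication by \<open>y\<^sup>i\<close> up to a nonzero
  factor that depends only on the resulting monomial.\<close>

lemma delta10_inv_nil: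
  fixes a :: "'n::finite wform"
  shows "delta10_inv a h m [] z * of_nat (size (filter_mset isl m)) =
     (\<Sum>i\<in>UNIV. if Inl i \<in># m then a h (m - {#Inl i#}) [Inl i] z else 0)"
  unfolding delta10_inv_def sum_distrib_right
proof (intro sum.cong refl, goal_cases)
  case (1 i)
  show ?case
  proof (cases "Inl i \<in># m")
    case True
    then obtain m0 where m0: "m = add_mset (Inl i) m0" by (metis insert_DiffM)
    have "of_nat (Suc (size (filter_mset isl m0))) \<noteq> (0 :: complex)"
      by (rule of_nat_neq_0)
    then show ?thesis by (simp add: y_mult_def contract_def m0)
  next
    case False
    then show ?thesis by (simp add: y_mult_def)
  qed
qed

text \<open>Gauge-fixed 1-forms are determined by their image under \<open>\<delta>\<close>, separately for each degree in the
  \<open>y\<close>'s and each power of \<open>\<hbar>\<close>.\<close>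

lemma gauge_fixed_eqI:
  fixes a b :: "'n::finite wform"
  assumes "\<And>m L. delta10_inv a h m L z = 0" "\<And>m L. delta10_inv b h m L z = 0"
    and "\<And>m L. pi0 a h m L z = 0" "\<And>m L. pi0 b h m L z = 0"
    and delta: "\<And>m L. Suc (size m) = n \<Longrightarrow> delta a h m L z = delta b h m L z"
    and "size m = n"
  shows "a h m [A] z = b h m [A] z"
proof -
  define d where "d m A = a h m [A] z - b h m [A] z" for m A
  have "d m A = 0"
  proof (rule closed_gauge_fixed_zero)
    show "(\<Sum>i\<in>UNIV. if Inl i \<in># m then d (m - {#Inl i#}) (Inl i) else 0) = 0" for m
    proof -
      have "(\<Sum>i\<in>UNIV. if Inl i \<in># m then d (m - {#Inl i#}) (Inl i) else 0) =
        (\<Sum>i\<in>UNIV. if Inl i \<in># m then a h (m - {#Inl i#}) [Inl i] z else 0)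
        - (\<Sum>i\<in>UNIV. if Inl i \<in># m then b h (m - {#Inl i#}) [Inl i] z else 0)"
        unfolding sum_subtractf[symmetric] by (intro sum.cong) (auto simp: d_def)
      also have "\<dots> = 0" unfolding delta10_inv_nil[symmetric] by (simp add: assms)
      finally show ?thesis .
    qed
    show "d m (Inr j) = 0" if "\<forall>A\<in>#m. \<not> isl A" for m j
      using assms(3,4)[of m "[Inr j]"] that by (simp add: d_def pi0_def)
    show "of_nat (Suc (count m A)) * d (add_mset A m) B =
        of_nat (Suc (count m B)) * d (add_mset B m) A" if "Suc (size m) = n" for m A B
      using delta[OF that, of "[A, B]"] unfolding delta_pair d_def by (simp add: algebra_simps)
  qed fact
  then show ?thesis by (simp add: d_def)
qed

section \<open>Weights in the Fedosov equation\<close>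

text \<open>The connection preserves the degree in the \<open>y\<close>'s.\<close>

lemma nabla_cong_degree:
  assumes "\<And>m'. size m' = size m \<Longrightarrow> a h m' = b h m'"
  shows "nabla w a h m = nabla w b h m"
proof -
  have "y_mult C (dy B a) h m L z = y_mult C (dy B b) h m L z" for B C L z
  proof (cases "C \<in># m")
    case True
    then have "size (add_mset B (m - {#C#})) = size m" by (metis insert_DiffM size_add_mset)
    from assms[OF this] True show ?thesis by (simp add: y_mult_def dy_def)
  qed (simp add: y_mult_def)
  then have "cov_deriv w A a h m = cov_deriv w A b h m" for A
    using assms[of m] by (intro ext) (simp add: cov_deriv_def)
  then show ?thesis by (simp add: nabla_def)
qed

lemma nabla_zero:
  fixes w :: "'n::finite dform"
  shows "nabla w (\<lambda>h m L z. 0) h m L z = 0"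
proof -
  have "pd A (\<lambda>z. 0) z = 0" for A :: "'n idx" and z
    by (auto simp: pd_def Let_def split: sum.split)
  moreover have "y_mult C (dy B (\<lambda>h m L z. 0)) h m L z = 0" for B C :: "'n idx" and h m L z
    by (simp add: y_mult_def dy_def)
  ultimately show ?thesis by (simp add: nabla_def dx_wedge_def cov_deriv_def)
qed

lemma foldr_dy:
  "\<exists>c. \<forall>a h L z. foldr (\<lambda>i. dy (f i)) is a h m L z = c * a h (m + mset (map f is)) L z"
proof (induction "is" arbitrary: m)
  case Nil
  show ?case by (intro exI[of _ 1]) simp
next
  case (Cons i "is")
  from Cons[of "add_mset (f i) m"] obtain c where
    "\<forall>a h L z. foldr (\<lambda>i. dy (f i)) is a h (add_mset (f i) m) L z =
      c * a h (add_mset (f i) m + mset (map f is)) L z" by blast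
  then show ?case
    by (intro exI[of _ "of_nat (Suc (count m (f i))) * c"]) (simp add: dy_def[of "f i"] mult.assoc)
qed

text \<open>The Wick product preserves the weight. Moreover a term of it with fewer powers of \<open>\<hbar>\<close> in the
  factors than in the product comes from a contraction, so that its second factor contains some
  \<open>ybar\<^sup>j\<close>. So the coefficient of \<open>\<hbar>\<^sup>h y\<^sup>m\<close> depends only on the products of coefficients of the factors
  that meet these two constraints.\<close>

lemma wick_cong_weight:
  assumes eq: "\<And>r m1 s m2 L1 L2.
      2 * r + size m1 + (2 * s + size m2) = 2 * h + size m \<Longrightarrow>
      r + s = h \<or> (\<exists>j. Inr j \<in># m2) \<Longrightarrow>
      a r m1 L1 z * b s m2 L2 z = a' r m1 L1 z * b' s m2 L2 z"
  shows "wick w a b h m L z = wick w a' b' h m L z"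
proof -
  have "wmult (foldr (\<lambda>i. dy (Inl i)) is a) (foldr (\<lambda>j. dy (Inr j)) js b) (h - k) m L z =
      wmult (foldr (\<lambda>i. dy (Inl i)) is a') (foldr (\<lambda>j. dy (Inr j)) js b') (h - k) m L z"
    if k: "k \<le> h" and "is": "length is = k" and js: "length js = k" for k "is" js
    unfolding wmult_def
  proof (intro sum.cong refl, goal_cases)
    case (1 r m1 S)
    then have r: "r \<le> h - k" and m1: "m1 \<subseteq># m" by auto
    let ?m1 = "m1 + mset (map Inl is)" and ?m2 = "m - m1 + mset (map Inr js)"
    obtain c where c: "\<And>a h L z. foldr (\<lambda>i. dy (Inl i)) is a h m1 L z = c * a h ?m1 L z"
      using foldr_dy by metis
    obtain c' where c': "\<And>a h L z. foldr (\<lambda>j. dy (Inr j)) js a h (m - m1) L z = c' * a h ?m2 L z"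
      using foldr_dy by metis
    have "size ?m2 = size m - size m1 + k"
      using m1 js by (simp only: size_union size_mset length_map size_Diff_submset)
    then have "2 * r + size ?m1 + (2 * (h - k - r) + size ?m2) = 2 * h + size m"
      using k r "is" js m1 size_mset_mono[OF m1] by simp
    moreover have "r + (h - k - r) = h \<or> (\<exists>j. Inr j \<in># ?m2)"
    proof (cases js)
      case Nil
      then show ?thesis using js r by simp
    next
      case (Cons j js')
      then show ?thesis by auto
    qed
    ultimately have p: "a r ?m1 (nths L S) z * b (h - k - r) ?m2 (nths L (- S)) z =
        a' r ?m1 (nths L S) z * b' (h - k - r) ?m2 (nths L (- S)) z"
      by (rule eq)
    have "shuffle_sign (length L) S * (c * x) * (c' * y) =
        shuffle_sign (length L) S * c * c' * (x * y)" for x y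
      by (simp add: ac_simps)
    with p show ?case unfolding c c' by simp
  qed
  then show ?thesis
    unfolding wick_def by (intro sum.cong refl arg_cong2[where f = "(*)"]) auto
qed

section \<open>Uniqueness in a chart\<close>

text \<open>The coordinate expression \<open>a\<close>, over the chart image \<open>U\<close> and extended by 0, of a 1-form which
  solves the Fedosov equation with right-hand side \<open>\<alpha>\<close> and satisfies both gauge conditions.\<close>

definition local_solution ::
    "'n::finite dform \<Rightarrow> (complex^'n) set \<Rightarrow> 'n wform \<Rightarrow> 'n wform \<Rightarrow> bool" where
  "local_solution w U \<alpha> a \<longleftrightarrow>
     (\<forall>h m L z. z \<notin> U \<or> length L \<noteq> 1 \<longrightarrow> a h m L z = 0) \<and>
     (\<forall>h m L. \<forall>z\<in>U.
        nabla w a h m L z - delta a h m L z + hbar_div (wick w a a) h m L z + R_nabla w h m L z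
          = \<alpha> h m L z \<and>
        delta10_inv a h m L z = 0 \<and> pi0 a h m L z = 0)"

lemma weyl_form_vanish:
  assumes "weyl_form \<A> p I" and "c \<notin> \<A> \<or> z \<notin> chart_image c \<or> length L \<noteq> p"
  shows "I c h m L z = 0"
proof -
  have "\<forall>c h m L z. c \<notin> \<A> \<or> z \<notin> chart_image c \<longrightarrow> I c h m L z = 0"
    "\<forall>c\<in>\<A>. \<forall>h m L. length L \<noteq> p \<longrightarrow> (\<forall>z. I c h m L z = 0)"
    using assms(1) unfolding weyl_form_def by - (elim conjE, assumption)+
  with assms(2) show ?thesis by blast
qed

lemma local_solution_support:
  assumes "local_solution w U \<alpha> a" "z \<notin> U \<or> length L \<noteq> 1"
  shows "a h m L z = 0"
  using assms by (auto simp: local_solution_def)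

lemma local_solution_gauge:
  assumes "local_solution w U \<alpha> a" "z \<in> U"
  shows "delta10_inv a h m L z = 0" "pi0 a h m L z = 0"
  using assms by (auto simp: local_solution_def)

lemma local_solution_delta:
  assumes "local_solution w U \<alpha> a" "z \<in> U"
  shows "delta a h m L z =
    nabla w a h m L z + wick w a a (Suc h) m L z + R_nabla w h m L z - \<alpha> h m L z"
proof -
  have "nabla w a h m L z - delta a h m L z + hbar_div (wick w a a) h m L z + R_nabla w h m L z
      = \<alpha> h m L z"
    using assms by (auto simp: local_solution_def)
  then show ?thesis by (simp add: hbar_div_def algebra_simps)
qed

lemma coeff_eqI:
  fixes a b :: "'n wform"
  assumes "\<And>L z. z \<notin> U \<or> length L \<noteq> 1 \<Longrightarrow> a h m L z = b h m L z"
    and "\<And>A z. z \<in> U \<Longrightarrow> a h m [A] z = b h m [A] z"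
  shows "a h m = b h m"
proof (intro ext)
  fix L z
  show "a h m L z = b h m L z"
  proof (cases "z \<in> U \<and> length L = 1")
    case True
    then obtain A where "L = [A]" by (auto simp: length_Suc_conv)
    with True assms(2) show ?thesis by simp
  qed (use assms(1) in auto)
qed

lemma zero_gauge_fixed:
  fixes m :: "'n::finite idx multiset"
  shows "delta10_inv (\<lambda>h m L z. 0) h m L z = 0" "pi0 (\<lambda>h m L z. 0) h m L z = 0"
  "delta (\<lambda>h m L z. 0) h m L z = 0"
proof -
  have "y_mult A (contract A (\<lambda>h m L z. 0)) h m L z = 0" for A :: "'n idx"
    by (simp add: y_mult_def contract_def)
  then show "delta10_inv (\<lambda>h m L z. 0) h m L z = 0" by (simp add: delta10_inv_def)
qed (simp_all add: pi0_def delta_def dx_wedge_def dy_def)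

lemma solution_low_weight:
  fixes a :: "'n::finite wform"
  assumes sol: "local_solution w U \<alpha> a"
    and \<alpha>: "\<And>L z. \<alpha> 0 {#} L z = 0"
    and weight: "2 * h + size m < 2"
  shows "a h m = (\<lambda>L z. 0)"
proof -
  let ?O = "\<lambda>h m L z. 0"
  have zeroI: "a 0 m = ?O 0 m"
    if "\<And>m' L z. z \<in> U \<Longrightarrow> Suc (size m') = size m \<Longrightarrow> delta a 0 m' L z = 0" for m
  proof (rule coeff_eqI)
    show "a 0 m [A] z = 0" if z: "z \<in> U" for A z
    proof (rule gauge_fixed_eqI[where b = ?O])
      show "delta a 0 m' L z = delta ?O 0 m' L z" if "Suc (size m') = size m" for m' L
        using \<open>\<And>m' L z. z \<in> U \<Longrightarrow> Suc (size m') = size m \<Longrightarrow> delta a 0 m' L z = 0\<close>[OF z that]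
        by (simp add: zero_gauge_fixed)
    qed (simp_all add: zero_gauge_fixed local_solution_gauge[OF sol z])
  qed (use local_solution_support[OF sol] in simp)
  have w0: "a 0 {#} = ?O 0 {#}"
    by (rule zeroI) simp
  have ybar: "a 0 {#Inr j#} L z = 0" for j L z
  proof (cases "z \<in> U \<and> length L = 1")
    case True
    then have z: "z \<in> U" by simp
    from True obtain A where L: "L = [A]" by (auto simp: length_Suc_conv)
    show ?thesis
    proof (cases A)
      case (Inl k)
      \<comment> \<open>The monomial \<open>y\<^sup>k ybar\<^sup>j\<close> occurs in \<open>(\<delta>\<^sup>1\<^sup>,\<^sup>0)\<^sup>-\<^sup>1 a\<close> only through \<open>ybar\<^sup>j dz\<^sup>k\<close>.\<close>
      have "(\<Sum>i\<in>UNIV. if Inl i \<in># {#Inl k, Inr j#}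
          then a 0 ({#Inl k, Inr j#} - {#Inl i#}) [Inl i] z else 0) = 0"
        using delta10_inv_nil[of a 0 "{#Inl k, Inr j#}" z] local_solution_gauge(1)[OF sol z]
        by (metis mult_zero_left)
      also have "(\<Sum>i\<in>UNIV. if Inl i \<in># {#Inl k, Inr j#}
          then a 0 ({#Inl k, Inr j#} - {#Inl i#}) [Inl i] z else 0) =
          (\<Sum>i\<in>UNIV. if i = k then a 0 {#Inr j#} [Inl k] z else 0)"
        by (intro sum.cong) auto
      finally show ?thesis by (simp add: L Inl)
    next
      case (Inr i)
      then show ?thesis
        using local_solution_gauge(2)[OF sol z, of 0 "{#Inr j#}" L] by (simp add: L pi0_def)
    qed
  qed (use local_solution_support[OF sol] in auto)
  have quadratic: "wick w a a (Suc 0) {#} L z = 0" for L z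
  proof -
    have "wick w a a (Suc 0) {#} L z = wick w ?O ?O (Suc 0) {#} L z"
    proof (rule wick_cong_weight)
      fix r s :: nat and m1 m2 :: "'n idx multiset" and L1 L2
      assume weights: "2 * r + size m1 + (2 * s + size m2) = 2 * Suc 0 + size {#}"
        and contraction: "r + s = Suc 0 \<or> (\<exists>j. Inr j \<in># m2)"
      have "(r = 0 \<and> m1 = {#}) \<or> (s = 0 \<and> m2 = {#}) \<or> (s = 0 \<and> (\<exists>j. m2 = {#Inr j#}))"
      proof (cases "r + s = Suc 0")
        case True
        with weights show ?thesis by (cases r) auto
      next
        case False
        with contraction obtain j m' where m2: "m2 = add_mset (Inr j) m'" by (metis insert_DiffM)
        with weights have "2 * r + size m1 + (2 * s + size m') = 1" by simp
        then have "r = 0 \<and> s = 0 \<and> size m1 + size m' = 1" by presburger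
        then have "r = 0 \<and> s = 0 \<and> (m1 = {#} \<or> m' = {#})" by (cases "size m1") auto
        with m2 show ?thesis by auto
      qed
      then show "a r m1 L1 z * a s m2 L2 z = 0 * 0"
        using w0 ybar by auto
    qed
    also have "\<dots> = 0"
    proof -
      have "foldr (\<lambda>i. dy (f i)) js ?O h m L z = 0" for f :: "'n \<Rightarrow> 'n idx" and js h m L z
        using foldr_dy[of f js m] by force
      then show ?thesis by (simp add: wick_def wmult_def)
    qed
    finally show ?thesis .
  qed
  have w1: "a 0 m = ?O 0 m" if m: "size m = 1" for m
  proof (rule zeroI)
    fix m' :: "'n idx multiset" and L z assume z: "z \<in> U" and "Suc (size m') = size m"
    then have m': "m' = {#}" using m by simp
    have "nabla w a 0 {#} = nabla w ?O 0 {#}"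
      by (rule nabla_cong_degree) (use w0 in simp)
    then show "delta a 0 m' L z = 0"
      unfolding m' local_solution_delta[OF sol z]
      by (simp add: nabla_zero quadratic \<alpha> R_nabla_def)
  qed
  have "h = 0" using weight by simp
  moreover have "size m = 0 \<or> size m = 1" using weight by linarith
  then have "m = {#} \<or> size m = 1" by simp
  ultimately show ?thesis using w0 w1 by auto
qed

lemma local_solution_unique:
  fixes a b :: "'n::finite wform"
  assumes a: "local_solution w U \<alpha> a" and b: "local_solution w U \<alpha> b"
    and \<alpha>: "\<And>L z. \<alpha> 0 {#} L z = 0"
  shows "a = b"
proof -
  have "a h m = b h m" if "2 * h + size m = n" for h m n
    using that
  proof (induction n arbitrary: h m rule: less_induct)
    case (less n)
    show ?case
    proof (rule coeff_eqI)
      show "a h m L z = b h m L z" if "z \<notin> U \<or> length L \<noteq> 1" for L z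
        using that by (simp add: local_solution_support[OF a] local_solution_support[OF b])
      fix A z assume z: "z \<in> U"
      show "a h m [A] z = b h m [A] z"
      proof (rule gauge_fixed_eqI)
        fix m' :: "'n idx multiset" and L assume m': "Suc (size m') = size m"
        have nabla: "nabla w a h m' = nabla w b h m'"
        proof (rule nabla_cong_degree)
          fix m'' :: "'n idx multiset" assume "size m'' = size m'"
          with m' less.prems have "2 * h + size m'' < n" by simp
          then show "a h m'' = b h m''" using less.IH by blast
        qed
        have "wick w a a (Suc h) m' L z = wick w b b (Suc h) m' L z"
        proof (rule wick_cong_weight)
          fix r s :: nat and m1 m2 :: "'n idx multiset" and L1 L2
          assume weights: "2 * r + size m1 + (2 * s + size m2) = 2 * Suc h + size m'"
          show "a r m1 L1 z * a s m2 L2 z = b r m1 L1 z * b s m2 L2 z"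
          proof (cases "2 * r + size m1 < 2 \<or> 2 * s + size m2 < 2")
            case True
            then show ?thesis
              using solution_low_weight[OF a \<alpha>] solution_low_weight[OF b \<alpha>] by force
          next
            case False
            \<comment> \<open>The weights of the two factors add up to \<open>n + 1\<close>.\<close>
            then have "2 * r + size m1 < n" "2 * s + size m2 < n"
              using weights m' less.prems by auto
            then show ?thesis using less.IH by metis
          qed
        qed
        then show "delta a h m' L z = delta b h m' L z"
          by (simp add: local_solution_delta[OF a z] local_solution_delta[OF b z] nabla)
      qed (simp_all add: local_solution_gauge[OF a z] local_solution_gauge[OF b z])
    qed
  qed
  then show ?thesis by (intro ext) metis
qed

theorem proposition2p22:
  fixes X :: "'a topology"
    and \<A> :: "('a, 'n::finite) chart set"
    and \<omega> :: "('a, 'n) chart \<Rightarrow> 'n dform"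
    and \<eta> :: "nat \<Rightarrow> ('a, 'n) chart \<Rightarrow> 'n dform"
  assumes "kahler_manifold X \<A> \<omega>"
    and "\<And>k. k \<ge> 1 \<Longrightarrow> diff_form \<A> 2 (\<eta> k)"
    and "\<And>k. k \<ge> 1 \<Longrightarrow> closed_form \<A> (\<eta> k)"
  shows "\<exists>\<^sub>\<le>\<^sub>1 I. weyl_form \<A> 1 I \<and>
           fedosov_equation \<A> \<omega> (formal_form \<eta>) I \<and>
           weyl_eq \<A> (\<lambda>c. delta10_inv (I c)) (\<lambda>c h m L z. 0) \<and>
           weyl_eq \<A> (\<lambda>c. pi0 (I c)) (\<lambda>c h m L z. 0)"
proof (rule Uniq_I)
  fix I J :: "('a, 'n) chart \<Rightarrow> 'n wform"
  let ?sol = "\<lambda>I. weyl_form \<A> 1 I \<and>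
           fedosov_equation \<A> \<omega> (formal_form \<eta>) I \<and>
           weyl_eq \<A> (\<lambda>c. delta10_inv (I c)) (\<lambda>c h m L z. 0) \<and>
           weyl_eq \<A> (\<lambda>c. pi0 (I c)) (\<lambda>c h m L z. 0)"
  assume IJ: "?sol I" "?sol J"
  have local: "local_solution (\<omega> c) (chart_image c) (formal_form \<eta> c) (I c)"
    if "?sol I" "c \<in> \<A>" for I c
    unfolding local_solution_def
  proof (intro conjI allI impI ballI)
    show "I c h m L z = 0" if "z \<notin> chart_image c \<or> length L \<noteq> 1" for h m L z
      using \<open>?sol I\<close> that by (blast intro: weyl_form_vanish)
  qed (use that in \<open>simp_all add: fedosov_equation_def weyl_eq_def\<close>)
  show "I = J"
  proof (rule ext)
    fix c
    show "I c = J c"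
    proof (cases "c \<in> \<A>")
      case True
      show ?thesis
        by (rule local_solution_unique[OF local[OF IJ(1) True] local[OF IJ(2) True]])
          (simp add: formal_form_def)
    next
      case False
      then have "I c h m L z = 0" "J c h m L z = 0" for h m L z
        using IJ by (blast intro: weyl_form_vanish)+
      then show ?thesis by (intro ext) simp
    qed
  qed
qed

end
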